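(* Let $n\ge 2$ and consider the single-source shortest path problem on the complete directed graph $G=(V,E)$ with $|V|=n$, a designated source $s\in V$, and an integer weight assignment $\ell\colon E\to\mathbb{Z}$ with no negative cycles. Consider query/relaxation-based algorithms (defined in the context) that use only edge queries and relaxation updates, and that are correct, i.e. for every weight assignment, when the computation ends, $D[v]$ equals the distance from $s$ to $v$ for every $v\in V$. (a) There is a constant $c>0$ such that for every $n$ and every deterministic such algorithm $\mathcal{A}$, there is a weight assignment $\ell$ on which the running time of $\mathcal{A}$ is at least $c n^3$; moreover, such an $\ell$ can be chosen with all weights non-negative and symmetric ($\ell_{uv}=\ell_{vu}$ for all $u\neq v$, i.e. the graph is effectively undirected). (b) The same $\Omega(n^3)$ lower bound holds for randomized such algorithms: there is a constant $c>0$ such that for every $n$ and every randomized such algorithm $\mathcal{R}$ (a probability distribution over deterministic such algorithms), there is a weight assignment $\ell$ on which the expected running time of $\mathcal{R}$ is at least $c n^3$.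
   Context: Model: each vertex $v$ carries a value $D[v]$ (the D-value). Initially $D[s]=0$ and $D[v]=\ell_{sv}$ for all $v\neq s$. An edge query for an edge $(u,v)$ asks "$D[u]+\ell_{uv}<D[v]$?" and returns yes/no. A relaxation update for an edge $(u,v)$ performs $D[v]\leftarrow\min\{D[v],D[u]+\ell_{uv}\}$. A deterministic algorithm is a (finite) decision tree whose internal nodes are queries (with a "yes" and a "no" child) or relaxation updates (with one child) and whose leaves are relaxation updates; on input $\ell$ it follows the path determined by the query outcomes. Each query or update counts as one step. The running time of an algorithm on $\ell$ is the number of steps performed until every $D[v]$ equals the distance (length of a shortest path) from $s$ to $v$ under $\ell$. Paths are simple paths.
   Formalization: The bound is stated for n ≥ 3 instead of n ≥ 2: for n = 2 the initial D-values already equal the distances, so every running time is 0 and no bound c·n³ with c > 0 can hold. *)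

theory Defs
  imports
    "HOL-Probability.Probability_Mass_Function"
    "Graph_Theory.Graph_Theory"
begin

text \<open>
  Graphs are digraphs whose arcs are pairs of vertices, so a weight assignment is a function
  on pairs; only its values on \<^term>\<open>parcs G\<close> are ever used below.
\<close>

type_synonym 'v weights = "'v \<times> 'v \<Rightarrow> int"

definition walk_length :: "'v weights \<Rightarrow> ('v \<times> 'v) list \<Rightarrow> int" where
  "walk_length l p = (\<Sum>e\<leftarrow>p. l e)"

definition no_negative_cycles :: "'v pair_pre_digraph \<Rightarrow> 'v weights \<Rightarrow> bool" where
  "no_negative_cycles G l \<longleftrightarrow>
     (\<forall>p. pre_digraph.cycle (with_proj G) p \<longrightarrow> 0 \<le> walk_length l p)"

text \<open>
  The predicate \<open>apath\<close> describes simple paths. In a finite graph there are only finitely many of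
  them, so \<^const>\<open>Min\<close> is a true minimum as soon as \<open>v\<close> is reachable from \<open>s\<close>.
\<close>

definition distance :: "'v pair_pre_digraph \<Rightarrow> 'v weights \<Rightarrow> 'v \<Rightarrow> 'v \<Rightarrow> int" where
  "distance G l s v = Min (walk_length l ` {p. pre_digraph.apath (with_proj G) s p v})"

text \<open>
  Decision trees over edges \<open>'e\<close>: \<open>Final\<close> is a leaf (a last relaxation update), \<open>Update\<close> an inner
  relaxation update, and \<open>Query e A B\<close> continues with \<open>A\<close> on answer yes and with \<open>B\<close> on
  answer no.
\<close>

datatype (alg_edges: 'e) algorithm =
    Final 'e
  | Update 'e "'e algorithm"
  | Query 'e "'e algorithm" "'e algorithm"

definition initial :: "'v \<Rightarrow> 'v weights \<Rightarrow> 'v \<Rightarrow> int" where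
  "initial s l v = (if v = s then 0 else l (s, v))"

fun relax :: "'v weights \<Rightarrow> 'v \<times> 'v \<Rightarrow> ('v \<Rightarrow> int) \<Rightarrow> 'v \<Rightarrow> int" where
  "relax l (u, v) D = D(v := min (D v) (D u + l (u, v)))"

fun query :: "'v weights \<Rightarrow> 'v \<times> 'v \<Rightarrow> ('v \<Rightarrow> int) \<Rightarrow> bool" where
  "query l (u, v) D \<longleftrightarrow> D u + l (u, v) < D v"

text \<open>
  The list of D-values before the first step, after the first step, after the second step,
  and so on until the computation ends; entry \<open>t\<close> is the state after \<open>t\<close> steps.
\<close>

fun trace :: "'v weights \<Rightarrow> ('v \<times> 'v) algorithm \<Rightarrow> ('v \<Rightarrow> int) \<Rightarrow> ('v \<Rightarrow> int) list" where
  "trace l (Final e) D = [D, relax l e D]"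
| "trace l (Update e A) D = D # trace l A (relax l e D)"
| "trace l (Query e A B) D = D # trace l (if query l e D then A else B) D"

definition all_distances ::
    "'v pair_pre_digraph \<Rightarrow> 'v \<Rightarrow> 'v weights \<Rightarrow> ('v \<Rightarrow> int) \<Rightarrow> bool" where
  "all_distances G s l D \<longleftrightarrow> (\<forall>v\<in>pverts G. D v = distance G l s v)"

definition correct_algorithm ::
    "'v pair_pre_digraph \<Rightarrow> 'v \<Rightarrow> ('v \<times> 'v) algorithm \<Rightarrow> bool" where
  "correct_algorithm G s A \<longleftrightarrow> alg_edges A \<subseteq> parcs G \<and>
     (\<forall>l. no_negative_cycles G l \<longrightarrow> all_distances G s l (last (trace l A (initial s l))))"

text \<open>
  For a correct algorithm and weights without negative cycles, the set of step numbers
  below is nonempty.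
\<close>

definition running_time ::
    "'v pair_pre_digraph \<Rightarrow> 'v \<Rightarrow> 'v weights \<Rightarrow> ('v \<times> 'v) algorithm \<Rightarrow> nat" where
  "running_time G s l A =
     (LEAST t. t < length (trace l A (initial s l)) \<and>
               all_distances G s l (trace l A (initial s l) ! t))"

text \<open>
  With two vertices the initial D-values are already the distances, so every running time is 0 and
  no positive lower bound can hold. Lower bounds on the running time therefore need at least three
  vertices.
\<close>

lemma running_time_two_vertices:
  assumes K: "complete_digraph 2 (with_proj G)" and s: "s \<in> pverts G"
  shows "running_time G s l A = 0"
proof -
  interpret P: pre_digraph "with_proj G" .
  have arcs: "parcs G = {(u, v). u \<in> pverts G \<and> v \<in> pverts G \<and> u \<noteq> v}"
    and card: "card (pverts G) = 2"
    using K by (auto simp: complete_digraph_def)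
  obtain w where V: "pverts G = {s, w}" "s \<noteq> w"
  proof -
    from card obtain x y where "pverts G = {x, y}" "x \<noteq> y"
      unfolding card_2_iff by blast
    with s that[of x] that[of y] show thesis
      by (metis insert_commute insertE singletonD)
  qed
  have E: "parcs G = {(s, w), (w, s)}"
    unfolding arcs V(1) using V(2) by blast
  have last_in: "v \<in> set (pawalk_verts u p)" if "pcas u p v" for u p and v :: 'a
    using that by (induction p arbitrary: u) auto
  have apath: "P.apath u p v \<longleftrightarrow>
      u \<in> pverts G \<and> set p \<subseteq> parcs G \<and> pcas u p v \<and> distinct (pawalk_verts u p)" for u p v
    by (simp add: P.apath_def P.awalk_def cas_with_proj_eq awalk_verts_with_proj_eq)
  have nil: "p = []" if "pcas u p u" "distinct (pawalk_verts u p)" for u :: 'a and p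
    using that last_in by (cases p) auto
  have 1: "{p. P.apath s p s} = {[]}"
    using s by (auto simp: apath dest: nil)
  have "p = [(s, w)]" if p: "P.apath s p w" for p
  proof (cases p)
    case Nil
    with p V(2) show ?thesis by (simp add: apath)
  next
    case (Cons e q)
    from p Cons have "e \<in> {(s, w), (w, s)}" "fst e = s"
      and q: "pcas (snd e) q w" "distinct (pawalk_verts (snd e) q)"
      by (simp_all add: apath E)
    then have "e = (s, w)" using V(2) by (metis fst_conv insertE singletonD)
    with q Cons nil show ?thesis by simp
  qed
  moreover have "P.apath s [(s, w)] w"
    using s V(2) by (simp add: apath E)
  ultimately have 2: "{p. P.apath s p w} = {[(s, w)]}" by blast
  have "all_distances G s l (initial s l)"
    using V(2) by (simp add: all_distances_def distance_def initial_def V(1) 1 2 walk_length_def)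
  moreover have "trace l A D ! 0 = D" "0 < length (trace l A D)" for D
    by (cases A; simp)+
  ultimately show ?thesis
    unfolding running_time_def by (intro Least_eq_0) auto
qed

end

theory Submission
  imports Defs "HOL-Combinatorics.Multiset_Permutations"
begin

text \<open>
  Order the vertices as \<open>s = v\<^sub>0, v\<^sub>1, \<dots>\<close>, let consecutive edges weigh \<open>n\<close>, let the other edges
  between \<open>v\<^sub>2\<^sub>j\<close> and later vertices weigh \<open>2n\<^sup>2 - j - 2jn\<close>, and let all remaining edges weigh \<open>2n\<^sup>2\<close>.
  The shortest path tree is the path \<open>v\<^sub>0, v\<^sub>1, \<dots>\<close>. Once \<open>v\<^sub>0, \<dots>, v\<^sub>2\<^sub>k\<close> have their final
  values, an edge from \<open>v\<^sub>2\<^sub>k\<close> to any later vertex looks improving, whether or not it is the edge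
  of the path, and after relaxing it the only edge that betrays the continuation of the path is
  \<open>(v\<^sub>2\<^sub>k\<^sub>+\<^sub>1, v\<^sub>2\<^sub>k\<^sub>+\<^sub>2)\<close>. So each second path edge has to be found by trying the ordered pairs of
  unrevealed vertices one by one. For a uniformly random order this takes at least \<open>m (m - 1) / 2\<close> steps
  on average when \<open>m\<close> vertices are unrevealed, and \<open>m\<close> then drops by two, which sums up
  to order \<open>n\<^sup>3\<close>. Since the average is over the weights for a fixed algorithm, it bounds randomized
  algorithms as well, and deterministic ones are the special case of a point distribution.
\<close>

section \<open>The weights of a vertex order\<close>

text \<open>The position of an element that does not occur is the length of the list.\<close>

definition position :: "'a list \<Rightarrow> 'a \<Rightarrow> nat" where
  "position xs u = length (takeWhile (\<lambda>x. x \<noteq> u) xs)"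

lemma position_append:
  "position (xs @ ys) u = (if u \<in> set xs then position xs u else length xs + position ys u)"
  by (induction xs) (auto simp: position_def)

lemma position_less_iff: "position xs u < length xs \<longleftrightarrow> u \<in> set xs"
  by (induction xs) (auto simp: position_def)

lemma position_nth: "distinct xs \<Longrightarrow> i < length xs \<Longrightarrow> position xs (xs ! i) = i"
proof (induction xs arbitrary: i)
  case (Cons a xs)
  then show ?case by (cases i) (auto simp: position_def)
qed simp

lemma nth_position: "u \<in> set xs \<Longrightarrow> xs ! position xs u = u"
  by (induction xs) (auto simp: position_def)

text \<open>The term \<open>int n * int (min i j)\<close> cancels the final value 2jn at position
  2j, so relaxing a non-path edge from there to a later vertex yields 2n^2 - j for every target.
  Subtracting j makes later even vertices improve strictly on earlier ones.\<close>

definition order_weight :: "nat \<Rightarrow> nat \<Rightarrow> nat \<Rightarrow> int" where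
  "order_weight n i j =
     (if max i j = Suc (min i j) then int n
      else if even (min i j) then 2 * int n * int n - int (min i j div 2) - int n * int (min i j)
      else 2 * int n * int n)"

definition order_weights :: "'v list \<Rightarrow> 'v weights" where
  "order_weights vs = (\<lambda>(u, v). order_weight (length vs) (position vs u) (position vs v))"

lemma order_weight_commute: "order_weight n i j = order_weight n j i"
  by (simp add: order_weight_def max.commute min.commute)

text \<open>The product with n is at most n^2 - n and the half position at most n, which leaves at
  least n^2. The bound n rather than 0 matters because it exceeds the difference of any two
  tentative D-values.\<close>

lemma order_weight_ge:
  assumes "i < n" "j < n"
  shows "int n \<le> order_weight n i j"
proof -
  define a where "a = min i j"
  have a: "a < n" using assms by (simp add: a_def)
  have "int n * int a \<le> int n * (int n - 1)" using a by (intro mult_left_mono) auto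
  also have "\<dots> = int n * int n - int n" by (simp add: right_diff_distrib)
  finally have 1: "int n * int a \<le> int n * int n - int n" .
  have "int n * 1 \<le> int n * int n" using a by (intro mult_left_mono) auto
  then have 2: "int n \<le> int n * int n" by simp
  have 3: "int (a div 2) \<le> int n" using a by linarith
  have 4: "2 * int n * int n = int n * int n + int n * int n" by simp
  have "int n \<le> 2 * int n * int n - int (a div 2) - int n * int a"
    using 1 2 3 unfolding 4 by linarith
  moreover have "int n \<le> 2 * int n * int n" using 2 unfolding 4 by linarith
  ultimately show ?thesis
    unfolding order_weight_def a_def[symmetric] by simp
qed

section \<open>The D-values during a run\<close>

text \<open>
  In a state \<open>(k, b)\<close> the vertices \<open>v\<^sub>0, \<dots>, v\<^sub>2\<^sub>k\<close> have their final values, and \<open>b x\<close> is the largest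
  \<open>j \<le> k\<close> such that \<open>(v\<^sub>2\<^sub>j, x)\<close> was relaxed usefully. How \<open>(k, b)\<close> evolves depends on the vertex order
  only through \<open>v\<^sub>0, \<dots>, v\<^sub>2\<^sub>k\<^sub>+\<^sub>2\<close>.
\<close>

definition state_value :: "nat \<Rightarrow> nat \<Rightarrow> nat \<Rightarrow> nat \<Rightarrow> int" where
  "state_value n k c i =
     (if i \<le> 2 * k \<or> i = 2 * k + 1 \<and> c = k then int n * int i else 2 * int n * int n - int c)"

definition tracks :: "'v list \<Rightarrow> nat \<Rightarrow> ('v \<Rightarrow> nat) \<Rightarrow> ('v \<Rightarrow> int) \<Rightarrow> bool" where
  "tracks vs k b D \<longleftrightarrow> 2 * k < length vs \<and> (\<forall>v. b v \<le> k) \<and>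
     (\<forall>i<length vs. D (vs ! i) = state_value (length vs) k (b (vs ! i)) i)"

text \<open>The Boolean is the answer to the query; the rest is the state after the relaxation. The
  guard \<open>2 * k + 2 < length vs\<close> keeps the default position of an absent vertex from
  passing as 2k + 2, so that prefixes of an order can be used as arguments.\<close>

definition advance ::
    "'v list \<Rightarrow> nat \<Rightarrow> ('v \<Rightarrow> nat) \<Rightarrow> 'v \<times> 'v \<Rightarrow> bool \<times> nat \<times> ('v \<Rightarrow> nat)" where
  "advance vs k b = (\<lambda>(u, v). let p = position vs u; q = position vs v in
     if 2 * k + 2 < length vs \<and> p = 2 * k + 1 \<and> q = 2 * k + 2 \<and> b u = k then (True, Suc k, b)
     else if even p \<and> p \<le> 2 * k \<and> 2 * k < q \<and> b v < p div 2 then (True, k, b(v := p div 2))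
     else (False, k, b))"

text \<open>A vertex outside the prefix has a position of at least \<open>length xs\<close> in both
  lists, so comparisons with 2k agree. Only the test for positions 2k + 1 and 2k + 2 looks further,
  which the second hypothesis covers.\<close>

lemma advance_append:
  assumes k: "2 * k < length xs"
    and "2 * k + 2 < length xs \<or>
         \<not> (position (xs @ ys) u = 2 * k + 1 \<and> position (xs @ ys) v = 2 * k + 2)"
  shows "advance (xs @ ys) k b (u, v) = advance xs k b (u, v)"
proof -
  have *: "position xs w = position (xs @ ys) w \<or>
      length xs \<le> position xs w \<and> length xs \<le> position (xs @ ys) w" for w
    using position_less_iff[of xs w] by (auto simp: position_append)
  define p q where "p = position (xs @ ys) u" and "q = position (xs @ ys) v"
  define p' q' where "p' = position xs u" and "q' = position xs v"
  have p: "p' = p \<or> length xs \<le> p' \<and> length xs \<le> p"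
    and q: "q' = q \<or> length xs \<le> q' \<and> length xs \<le> q"
    using *[of u] *[of v] by (auto simp: p_def q_def p'_def q'_def)
  have "2 * k + 2 < length (xs @ ys) \<and> p = 2 * k + 1 \<and> q = 2 * k + 2 \<longleftrightarrow>
      2 * k + 2 < length xs \<and> p' = 2 * k + 1 \<and> q' = 2 * k + 2"
    using p q assms(2) unfolding p_def[symmetric] q_def[symmetric] by auto
  moreover have "p \<le> 2 * k \<longleftrightarrow> p' \<le> 2 * k" "2 * k < q \<longleftrightarrow> 2 * k < q'"
    using p q k by auto
  moreover have "p = p'" if "p \<le> 2 * k" using p k that by auto
  ultimately show ?thesis
    unfolding advance_def Let_def prod.case p_def[symmetric] q_def[symmetric]
      p'_def[symmetric] q'_def[symmetric]
    by (smt (verit, best))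
qed

text \<open>The cases ask whether target and source have their final values. A final value is never
  undercut; a tentative value 2n^2 - c improves only through a final v_{2j} with j > c, or through
  the path edge into v_{2k+2}.\<close>

lemma tracks_advance:
  assumes tr: "tracks vs k b D" and dist: "distinct vs"
    and u: "u \<in> set vs" and v: "v \<in> set vs" and uv: "u \<noteq> v"
    and adv: "advance vs k b (u, v) = (a, k', b')"
  shows "query (order_weights vs) (u, v) D = a \<and> tracks vs k' b' (relax (order_weights vs) (u, v) D)"
proof -
  define n where "n = length vs"
  define p where "p = position vs u"
  define q where "q = position vs v"
  have pq: "p < n" "q < n" "p \<noteq> q" "vs ! p = u" "vs ! q = v"
    using u v uv nth_position[of u vs] nth_position[of v vs]
    by (auto simp: p_def q_def n_def position_less_iff)
  have eq: "vs ! i = v \<longleftrightarrow> i = q" if "i < n" for i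
    using that dist pq nth_eq_iff_index_eq[of vs i q] by (auto simp: n_def)
  have kn: "2 * k < n" and bk: "\<And>w. b w \<le> k"
    and D: "\<And>i. i < n \<Longrightarrow> D (vs ! i) = state_value n k (b (vs ! i)) i"
    using tr by (auto simp: tracks_def n_def)
  define w where "w = order_weight n p q"
  have l: "order_weights vs (u, v) = w"
    by (simp add: order_weights_def w_def p_def q_def n_def)
  have wn: "int n \<le> w" using order_weight_ge pq unfolding w_def by blast
  have Du: "D u = state_value n k (b u) p" and Dv: "D v = state_value n k (b v) q"
    using D[of p] D[of q] pq by auto
  \<comment> \<open>Every final value lies below every tentative one.\<close>
  have big: "int n * int i < 2 * int n * int n - int c" if "i < n" "c \<le> k" for i c
  proof -
    have "int n * int i \<le> int n * (int n - 1)" using that by (intro mult_left_mono) auto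
    also have "\<dots> = int n * int n - int n" by (simp add: right_diff_distrib)
    finally have 1: "int n * int i \<le> int n * int n - int n" .
    have "int n * 1 \<le> int n * int n" using kn by (intro mult_left_mono) auto
    then have 2: "int n \<le> int n * int n" by simp
    have 3: "int c < int n" using that kn by linarith
    have "2 * int n * int n = int n * int n + int n * int n" by simp
    then show ?thesis using 1 2 3 by linarith
  qed
  have unchanged: ?thesis if "D v \<le> D u + w" "advance vs k b (u, v) = (False, k, b)"
  proof -
    have "relax (order_weights vs) (u, v) D = D" using that by (simp add: l min_def)
    then show ?thesis using that tr adv by (auto simp: l)
  qed
  have adv': "advance vs k b (u, v) =
    (if 2 * k + 2 < n \<and> p = 2 * k + 1 \<and> q = 2 * k + 2 \<and> b u = k then (True, Suc k, b)
     else if even p \<and> p \<le> 2 * k \<and> 2 * k < q \<and> b v < p div 2 then (True, k, b(v := p div 2))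
     else (False, k, b))"
    by (simp add: advance_def Let_def p_def q_def n_def)
  define known where "known i c \<longleftrightarrow> i \<le> 2 * k \<or> i = 2 * k + 1 \<and> c = k" for i c
  have val: "state_value n k c i = (if known i c then int n * int i else 2 * int n * int n - int c)"
    for c i by (simp add: state_value_def known_def)
  show ?thesis
  proof (cases "known q (b v)")
    case v_known: True
    have "D v = int n * int q" using v_known by (simp add: Dv val)
    moreover have "int n * int q \<le> D u + w"
    proof (cases "known p (b u)")
      case False
      then have "D u = 2 * int n * int n - int (b u)" by (simp add: Du val)
      then show ?thesis using big[of q "b u"] bk[of u] pq wn by simp
    next
      case True
      then have Du': "D u = int n * int p" by (simp add: Du val)
      consider "q < p" | "q = Suc p" | "Suc p < q" using pq by linarith
      then show ?thesis
      proof cases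
        case 1
        then have "int n * int q \<le> int n * int p" by (intro mult_left_mono) auto
        then show ?thesis using wn Du' by simp
      next
        case 2
        then have "w = int n" by (simp add: w_def order_weight_def)
        then show ?thesis using 2 Du' by (simp add: algebra_simps)
      next
        \<comment> \<open>An edge that skips path vertices: for either parity of p the weight is at
          least 2n^2 - p div 2 - np, so the offer exceeds all final values.\<close>
        case 3
        then have "p div 2 \<le> k" using v_known by (auto simp: known_def)
        then have "int n * int q < 2 * int n * int n - int (p div 2)" using big pq by blast
        moreover have "0 \<le> int n * int p" by simp
        moreover have "- int (p div 2) \<le> int n * int p"
          using \<open>0 \<le> int n * int p\<close> by linarith
        then have "2 * int n * int n - int (p div 2) - int n * int p \<le> w"
          using 3 by (auto simp: w_def order_weight_def)
        ultimately show ?thesis using Du' by linarith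
      qed
    qed
    ultimately have "D v \<le> D u + w" by simp
    moreover have "advance vs k b (u, v) = (False, k, b)"
      using v_known unfolding adv' known_def by auto
    ultimately show ?thesis by (rule unchanged)
  next
    case v_unknown: False
    then have Dv': "D v = 2 * int n * int n - int (b v)" by (simp add: Dv val)
    have q: "2 * k < q" using v_unknown by (auto simp: known_def)
    show ?thesis
    proof (cases "known p (b u)")
      case u_unknown: False
      then have "D u = 2 * int n * int n - int (b u)" by (simp add: Du val)
      \<comment> \<open>Two tentative values differ by at most k < n, which the weight
        outweighs.\<close>
      then have "D v \<le> D u + w" using wn Dv' bk[of u] kn by simp
      moreover have "advance vs k b (u, v) = (False, k, b)"
        using u_unknown unfolding adv' known_def by auto
      ultimately show ?thesis by (rule unchanged)
    next
      case u_known: True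
      then have Du': "D u = int n * int p" by (simp add: Du val)
      have pq': "p < q" using q u_known pq(3) by (auto simp: known_def)
      show ?thesis
      proof (cases "p \<le> 2 * k \<and> even p")
        case True
        have pk: "p div 2 \<le> k" using True by auto
        have bu: "p = 2 * k + 1 \<Longrightarrow> False" using True by auto
        define c where "c = p div 2"
        \<comment> \<open>The offer is exactly what the invariant prescribes for v once
          \<open>b v\<close> is c, and it is final just when q = p + 1.\<close>
        have sum: "D u + w = (if known q c then int n * int q else 2 * int n * int n - int c)"
        proof (cases "q = Suc p")
          case True': True
          then have "p = 2 * k" using q \<open>p \<le> 2 * k \<and> even p\<close> by simp
          then have "known q c" using True' by (simp add: known_def c_def)
          moreover have "w = int n" using True' by (simp add: w_def order_weight_def)
          ultimately show ?thesis using True' Du' by (simp add: algebra_simps)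
        next
          case False
          then have "\<not> known q c" using q True by (auto simp: known_def c_def)
          moreover have "w = 2 * int n * int n - int c - int n * int p"
            using False pq' True by (auto simp: w_def order_weight_def c_def)
          ultimately show ?thesis using Du' by simp
        qed
        show ?thesis
        proof (cases "b v < c")
          case False
          then have "\<not> known q c"
            using v_unknown bk[of v] by (auto simp: known_def)
          then have "D v \<le> D u + w" using sum Dv' False by simp
          moreover have "advance vs k b (u, v) = (False, k, b)"
            using False bu unfolding adv' c_def by auto
          ultimately show ?thesis by (rule unchanged)
        next
          case less: True
          have "advance vs k b (u, v) = (True, k, b(v := c))"
            using less bu True q unfolding adv' c_def by auto
          then have res: "a" "k' = k" "b' = b(v := c)" using adv by auto
          have lt: "D u + w < D v"
            using sum Dv' less big[of q "b v"] bk[of v] pq by auto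
          then have "relax (order_weights vs) (u, v) D = D(v := D u + w)"
            by (simp add: l min_def)
          moreover have "tracks vs k (b(v := c)) (D(v := D u + w))"
            unfolding tracks_def n_def[symmetric]
            using kn bk pk D by (auto simp: c_def eq sum[unfolded c_def] val)
          ultimately show ?thesis using lt res by (simp add: l)
        qed
      next
        case False
        show ?thesis
        proof (cases "p = 2 * k + 1 \<and> q = 2 * k + 2")
          case True
          then have bu: "b u = k" using u_known by (simp add: known_def)
          have "advance vs k b (u, v) = (True, Suc k, b)"
            using True bu pq unfolding adv' by auto
          then have res: "a" "k' = Suc k" "b' = b" using adv by auto
          have "w = int n" using True by (simp add: w_def order_weight_def)
          then have sum: "D u + w = int n * int q" using Du' True by (simp add: algebra_simps)
          then have lt: "D u + w < D v" using Dv' big[of q "b v"] bk[of v] pq by auto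
          then have "relax (order_weights vs) (u, v) D = D(v := D u + w)"
            by (simp add: l min_def)
          moreover have "tracks vs (Suc k) b (D(v := D u + w))"
            unfolding tracks_def n_def[symmetric]
          proof (intro conjI allI impI)
            show "2 * Suc k < n" using True pq by simp
            show "b x \<le> Suc k" for x using bk[of x] by simp
            fix i assume i: "i < n"
            show "(D(v := D u + w)) (vs ! i) = state_value n (Suc k) (b (vs ! i)) i"
            proof (cases "i = q")
              case True
              then show ?thesis using \<open>p = 2 * k + 1 \<and> q = 2 * k + 2\<close> pq sum
                by (simp add: state_value_def)
            next
              case ne: False
              \<comment> \<open>Besides q, two positions matter when k grows: v_{2k+1} is u, already
                final, and v_{2k+3} does not become final because no \<open>b\<close> value reaches
                k + 1.\<close>
              have "i = 2 * k + 1 \<Longrightarrow> b (vs ! i) = k" using True bu pq by auto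
              moreover have "b (vs ! i) \<noteq> Suc k" using bk[of "vs ! i"] by simp
              ultimately show ?thesis
                using ne True D[OF i] eq[OF i] i
                by (auto simp: state_value_def)
            qed
          qed
          ultimately show ?thesis using lt res by (simp add: l)
        next
          case no_hit: False
          have "p \<le> 2 * k \<or> p = 2 * k + 1" using u_known by (auto simp: known_def)
          \<comment> \<open>An odd p below 2k has its path successor at or before 2k < q, and p = 2k
            + 1 with q = 2k + 2 is excluded; so only the useless weight 2n^2 remains.\<close>
          then have "q \<noteq> Suc p" "odd p" using False no_hit q by presburger+
          then have "w = 2 * int n * int n"
            using pq' by (auto simp: w_def order_weight_def)
          moreover have "0 \<le> int n * int p" by simp
          ultimately have "D v \<le> D u + w" using Du' Dv' by linarith
          moreover have "advance vs k b (u, v) = (False, k, b)"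
            using no_hit \<open>odd p\<close> unfolding adv' by auto
          ultimately show ?thesis by (rule unchanged)
        qed
      qed
    qed
  qed
qed

section \<open>Averaging over permutations\<close>

text \<open>With m + 2 unrevealed vertices, half of the (m + 2)(m + 1) ordered pairs are charged,
  and m vertices remain.\<close>

fun average_bound :: "nat \<Rightarrow> real" where
  "average_bound (Suc (Suc m)) = real (Suc (Suc m) * Suc m) / 2 + average_bound m"
| "average_bound m = 0"

lemma average_bound_nonneg: "0 \<le> average_bound m"
  by (induction m rule: average_bound.induct) auto

text \<open>The cubic vanishes at 0 and 1 and grows by (m + 1)^2 / 2 from m to m + 2, less than the
  recursion adds.\<close>

lemma average_bound_ge: "(real m ^ 3 - real m) / 12 \<le> average_bound m"
proof (induction m rule: average_bound.induct)
  case (1 m)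
  then show ?case by (simp add: power3_eq_cube field_simps)
qed auto

text \<open>The constant comes from n = 3, where the cubic for n - 1 is 6/12 = 27/54.\<close>

lemma average_bound_ge_cube:
  assumes "n \<ge> 3"
  shows "1 / 54 * real n ^ 3 \<le> average_bound (n - 1)"
proof -
  obtain k where n: "n = k + 3" using assms by (metis add.commute le_Suc_ex)
  have "1 / 54 * real n ^ 3 \<le> (real (n - 1) ^ 3 - real (n - 1)) / 12"
    by (simp add: n power3_eq_cube field_simps)
  then show ?thesis using average_bound_ge[of "n - 1"] by linarith
qed

text \<open>Recursion along the tree suits induction better than the least index in
  \<open>running_time\<close>. A leaf is charged 1 without testing the state after it, so the
  function is a lower bound that makes sense even if \<open>P\<close> never holds.\<close>

fun steps_until ::
    "(('v \<Rightarrow> int) \<Rightarrow> bool) \<Rightarrow> 'v weights \<Rightarrow> ('v \<times> 'v) algorithm \<Rightarrow> ('v \<Rightarrow> int) \<Rightarrow> nat" where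
  "steps_until P l (Final e) D = (if P D then 0 else 1)"
| "steps_until P l (Update e A) D = (if P D then 0 else Suc (steps_until P l A (relax l e D)))"
| "steps_until P l (Query e A B) D =
     (if P D then 0 else Suc (steps_until P l (if query l e D then A else B) D))"

lemma steps_until_le:
  "t < length (trace l A D) \<Longrightarrow> P (trace l A D ! t) \<Longrightarrow> steps_until P l A D \<le> t"
proof (induction A arbitrary: t D)
  case (Final e)
  then show ?case by (cases t) auto
next
  case (Update e A)
  then show ?case by (cases t) auto
next
  case (Query e A B)
  then show ?case by (cases t) (auto split: if_splits)
qed

lemma trace_not_Nil: "trace l A D \<noteq> []"
  by (cases A) auto

lemma steps_until_le_running_time:
  assumes "correct_algorithm G s A" "no_negative_cycles G l"
  shows "steps_until (all_distances G s l) l A (initial s l) \<le> running_time G s l A"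
proof -
  let ?tr = "trace l A (initial s l)"
  let ?P = "\<lambda>t. t < length ?tr \<and> all_distances G s l (?tr ! t)"
  have "?P (length ?tr - 1)"
    using assms trace_not_Nil[of l A "initial s l"]
    by (auto simp: correct_algorithm_def last_conv_nth)
  then have "?P (LEAST t. ?P t)" by (rule LeastI)
  then show ?thesis unfolding running_time_def by (intro steps_until_le) auto
qed

section \<open>Sums over permutations split by their first entries\<close>

lemma sum_permutations_of_set_Cons:
  assumes "finite U" "U \<noteq> {}"
  shows "(\<Sum>ys\<in>permutations_of_set U. f ys) =
    (\<Sum>x\<in>U. \<Sum>zs\<in>permutations_of_set (U - {x}). f (x # zs))"
proof -
  have "(\<Sum>ys\<in>permutations_of_set U. f ys) =
      (\<Sum>x\<in>U. \<Sum>ys\<in>(#) x ` permutations_of_set (U - {x}). f ys)"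
    unfolding permutations_of_set_nonempty[OF assms(2)]
    by (rule sum.UNION_disjoint) (use assms in auto)
  then show ?thesis by (simp add: sum.reindex)
qed

lemma sum_permutations_of_set_Cons_Cons:
  assumes U: "finite U" "card U \<ge> 2"
  shows "(\<Sum>ys\<in>permutations_of_set U. f ys) =
    (\<Sum>(x, y)\<in>{(x, y). x \<in> U \<and> y \<in> U \<and> x \<noteq> y}.
       \<Sum>zs\<in>permutations_of_set (U - {x, y}). f (x # y # zs))"
proof -
  have ne: "U - {x} \<noteq> {}" for x
  proof
    assume "U - {x} = {}"
    then have "card U \<le> card {x}" by (intro card_mono) auto
    then show False using U by simp
  qed
  then have "U \<noteq> {}" by auto
  have "(\<Sum>ys\<in>permutations_of_set U. f ys) = (\<Sum>x\<in>U. \<Sum>y\<in>U - {x}.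
      \<Sum>zs\<in>permutations_of_set (U - {x, y}). f (x # y # zs))"
  proof (subst sum_permutations_of_set_Cons[OF U(1) \<open>U \<noteq> {}\<close>], rule sum.cong)
    fix x
    have "U - {x} - {y} = U - {x, y}" for y by auto
    then show "(\<Sum>zs\<in>permutations_of_set (U - {x}). f (x # zs)) =
        (\<Sum>y\<in>U - {x}. \<Sum>zs\<in>permutations_of_set (U - {x, y}). f (x # y # zs))"
      using sum_permutations_of_set_Cons[of "U - {x}" "\<lambda>zs. f (x # zs)"] U ne by simp
  qed simp
  also have "\<dots> = (\<Sum>(x, y)\<in>Sigma U (\<lambda>x. U - {x}).
       \<Sum>zs\<in>permutations_of_set (U - {x, y}). f (x # y # zs))"
    by (rule sum.Sigma) (use U in auto)
  also have "Sigma U (\<lambda>x. U - {x}) = {(x, y). x \<in> U \<and> y \<in> U \<and> x \<noteq> y}" by auto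
  finally show ?thesis .
qed

lemma card_off_diagonal:
  assumes "finite U"
  shows "card {(x, y). x \<in> U \<and> y \<in> U \<and> x \<noteq> y} = card U * (card U - 1)"
proof -
  have "{(x, y). x \<in> U \<and> y \<in> U \<and> x \<noteq> y} = Sigma U (\<lambda>x. U - {x})" by auto
  then show ?thesis using assms by simp
qed

text \<open>
  Here \<open>f\<close> is the time before and \<open>g\<close> the time after a step that tests the pair \<open>e\<close>, and \<open>a\<close> bounds the
  average time left once the pair is found.
\<close>

lemma average_step:
  assumes U: "finite U" and Q: "Q \<subseteq> {(x, y). x \<in> U \<and> y \<in> U \<and> x \<noteq> y}" and a: "0 \<le> a"
    and hit: "e \<in> Q \<Longrightarrow> fact (card U - 2) * a \<le>
      (\<Sum>zs\<in>permutations_of_set (U - {fst e, snd e}). g (fst e) (snd e) zs)"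
    and rest: "fact (card U - 2) * (real (card (Q - {e})) ^ 2 / 2 + real (card (Q - {e})) * a) \<le>
      (\<Sum>(x, y)\<in>Q - {e}. \<Sum>zs\<in>permutations_of_set (U - {x, y}). g x y zs)"
    and f: "\<And>x y zs. (x, y) \<in> Q \<Longrightarrow> zs \<in> permutations_of_set (U - {x, y}) \<Longrightarrow>
      f x y zs = g x y zs + 1"
  shows "fact (card U - 2) * (real (card Q) ^ 2 / 2 + real (card Q) * a) \<le>
    (\<Sum>(x, y)\<in>Q. \<Sum>zs\<in>permutations_of_set (U - {x, y}). f x y zs)"
proof -
  define N :: real where "N = fact (card U - 2)"
  define r where "r = real (card Q)"
  define S where "S = (\<lambda>(x, y). \<Sum>zs\<in>permutations_of_set (U - {x, y}). g x y zs)"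
  have N: "0 \<le> N" by (simp add: N_def)
  have "Q \<subseteq> U \<times> U" using Q by auto
  then have finQ: "finite Q" using U by (meson finite_SigmaI finite_subset)
  have S_e: "S e = (\<Sum>zs\<in>permutations_of_set (U - {fst e, snd e}). g (fst e) (snd e) zs)"
    by (simp add: S_def split_beta)
  have "(\<Sum>zs\<in>permutations_of_set (U - {x, y}). f x y zs) = S (x, y) + N" if "(x, y) \<in> Q" for x y
  proof -
    have "x \<in> U" "y \<in> U" "x \<noteq> y" using that Q by auto
    then have "card (U - {x, y}) = card U - 2"
      using U by (subst card_Diff_subset) auto
    then have "card (permutations_of_set (U - {x, y})) = fact (card U - 2)"
      using U by simp
    then show ?thesis using that by (simp add: f sum.distrib S_def N_def)
  qed
  then have "(\<Sum>(x, y)\<in>Q. \<Sum>zs\<in>permutations_of_set (U - {x, y}). f x y zs) =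
      (\<Sum>p\<in>Q. S p + N)"
    by (intro sum.cong) auto
  also have "\<dots> = sum S Q + r * N" by (simp add: sum.distrib r_def)
  finally have sum: "(\<Sum>(x, y)\<in>Q. \<Sum>zs\<in>permutations_of_set (U - {x, y}). f x y zs) = sum S Q + r * N" .
  have rest': "N * (real (card (Q - {e})) ^ 2 / 2 + real (card (Q - {e})) * a) \<le> sum S (Q - {e})"
    using rest by (simp add: N_def S_def)
  \<comment> \<open>N orders share each leading pair, so the step costs r N in total. If e is a
    candidate, the remaining r - 1 pairs suffice because (r - 1)^2 / 2 + r = r^2 / 2 + 1/2.\<close>
  have "N * (r ^ 2 / 2 + r * a) \<le> sum S Q + r * N"
  proof (cases "e \<in> Q")
    case False
    moreover have "0 \<le> r * N" using N by (simp add: r_def)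
    ultimately show ?thesis using rest' by (simp add: r_def)
  next
    case True
    then have "card Q > 0" using finQ card_gt_0_iff by blast
    then have r: "real (card (Q - {e})) = r - 1"
      using True finQ by (simp add: r_def card_Diff_singleton of_nat_diff)
    have "N * a + N * ((r - 1) ^ 2 / 2 + (r - 1) * a) \<le> S e + sum S (Q - {e})"
      using hit[OF True] rest' unfolding r S_e N_def by linarith
    also have "\<dots> = sum S Q" using sum.remove[OF finQ True, of S] by simp
    finally have "N * a + N * ((r - 1) ^ 2 / 2 + (r - 1) * a) \<le> sum S Q" .
    moreover have "N * a + N * ((r - 1) ^ 2 / 2 + (r - 1) * a) + r * N =
        N * (r ^ 2 / 2 + r * a) + N / 2"
      by (simp add: power2_eq_square field_simps)
    ultimately show ?thesis using N by linarith
  qed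
  then show ?thesis unfolding sum by (simp add: N_def r_def)
qed

lemma advance_bound:
  "2 * k < length xs \<Longrightarrow> advance xs k b e = (a, k', b') \<Longrightarrow> 2 * k' < length xs"
  by (cases e) (auto simp: advance_def Let_def split: if_splits)

section \<open>Runs on a random vertex order\<close>

lemma pcas_zip_tl: "ws \<noteq> [] \<Longrightarrow> pcas (hd ws) (zip ws (tl ws)) (last ws)"
proof (induction ws)
  case (Cons a ws)
  then show ?case by (cases ws) auto
qed simp

lemma pawalk_verts_zip_tl: "ws \<noteq> [] \<Longrightarrow> pawalk_verts (hd ws) (zip ws (tl ws)) = ws"
proof (induction ws)
  case (Cons a ws)
  then show ?case by (cases ws) auto
qed simp

locale complete_graph_order =
  fixes G :: "'v pair_pre_digraph" and s :: 'v and n :: nat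
  assumes complete: "complete_digraph n (with_proj G)" and s: "s \<in> pverts G"
begin

lemma finite_verts: "finite (pverts G)"
  and card_verts: "card (pverts G) = n"
  and arcs: "parcs G = {(u, v). u \<in> pverts G \<and> v \<in> pverts G \<and> u \<noteq> v}"
  using complete unfolding complete_digraph_pair_def by auto

sublocale pair_graph G
  by (rule pair_graphI_complete) (rule complete)

section \<open>Vertex orders and the distances under their weights\<close>

definition order :: "'v list \<Rightarrow> bool" where
  "order vs \<longleftrightarrow> distinct vs \<and> set vs = pverts G \<and> hd vs = s"

lemma order_length: "order vs \<Longrightarrow> length vs = n"
  by (metis card_verts distinct_card order_def)

lemma order_nth_0: "order vs \<Longrightarrow> vs ! 0 = s"
  using s by (cases vs) (auto simp: order_def)

lemma order_weights_arc_ge: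
  assumes "order vs" "e \<in> parcs G"
  shows "int n \<le> order_weights vs e"
proof -
  obtain u v where e: "e = (u, v)" "u \<in> set vs" "v \<in> set vs"
    using assms by (auto simp: order_def arcs)
  then have "position vs u < n" "position vs v < n"
    using order_length[OF assms(1)] by (auto simp: position_less_iff[symmetric])
  then show ?thesis
    using order_weight_ge order_length[OF assms(1)] by (simp add: e order_weights_def)
qed

lemma order_weights_symmetric: "order_weights vs (u, v) = order_weights vs (v, u)"
  by (simp add: order_weights_def order_weight_commute)

lemma no_negative_cycles_order:
  assumes "order vs"
  shows "no_negative_cycles G (order_weights vs)"
proof -
  have "0 \<le> walk_length (order_weights vs) p" if "cycle p" for p
  proof -
    have "set p \<subseteq> parcs G" using that by (auto simp: cycle_def awalk_def)
    then have "0 \<le> order_weights vs e" if "e \<in> set p" for e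
      using that order_weights_arc_ge[OF assms, of e] by fastforce
    then show ?thesis unfolding walk_length_def by (intro sum_list_nonneg) auto
  qed
  then show ?thesis by (simp add: no_negative_cycles_def)
qed

lemma distance_order_le:
  assumes vs: "order vs" and j: "j < n"
  shows "distance G (order_weights vs) s (vs ! j) \<le> int n * int j"
proof -
  define ws where "ws = take (Suc j) vs"
  define p where "p = zip ws (tl ws)"
  have len: "length vs = n" using vs by (rule order_length)
  have hd: "hd vs = s" and dist: "distinct vs" and set: "set vs = pverts G"
    using vs by (simp_all add: order_def)
  have "ws = take j vs @ [vs ! j]"
    unfolding ws_def by (rule take_Suc_conv_app_nth) (simp add: len j)
  then have "last ws = vs ! j" by simp
  moreover have "set ws \<subseteq> pverts G" using set_take_subset[of "Suc j" vs] set by (simp add: ws_def)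
  moreover have "ws \<noteq> []" "length ws = Suc j" "distinct ws" "hd ws = s"
    using j len dist hd by (auto simp: ws_def)
  ultimately have ws: "ws \<noteq> []" "length ws = Suc j" "distinct ws" "set ws \<subseteq> pverts G"
    "hd ws = s" "last ws = vs ! j"
    by blast+
  have nth: "p ! i = (vs ! i, vs ! Suc i)" "vs ! i \<noteq> vs ! Suc i" if "i < j" for i
    using that ws(2) dist j len nth_eq_iff_index_eq[of vs i "Suc i"]
    by (simp_all add: p_def ws_def nth_tl)
  have lenp: "length p = j" using ws by (simp add: p_def)
  have "set p \<subseteq> parcs G"
  proof
    fix e assume "e \<in> set p"
    then obtain i where "i < j" "e = p ! i" by (auto simp: in_set_conv_nth lenp)
    moreover have "vs ! i \<in> set vs" "vs ! Suc i \<in> set vs" if "i < j" for i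
      using that j len by auto
    ultimately show "e \<in> parcs G" using nth[of i] vs by (simp add: arcs order_def)
  qed
  then have "apath s p (vs ! j)"
    using pcas_zip_tl[OF ws(1)] pawalk_verts_zip_tl[OF ws(1)] ws s
    by (simp add: apath_def awalk_def p_def)
  then have "distance G (order_weights vs) s (vs ! j) \<le> walk_length (order_weights vs) p"
    unfolding distance_def using apaths_finite by (intro Min_le) auto
  also have "\<dots> = (\<Sum>i<j. order_weights vs (p ! i))"
    unfolding walk_length_def by (simp add: sum_list_sum_nth lenp atLeast0LessThan)
  also have "\<dots> = (\<Sum>i<j. int n)"
  proof (rule sum.cong)
    fix i assume "i \<in> {..<j}"
    then have "position vs (vs ! i) = i" "position vs (vs ! Suc i) = Suc i"
      using vs len j by (auto simp: position_nth order_def)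
    then show "order_weights vs (p ! i) = int n"
      using nth \<open>i \<in> {..<j}\<close> len by (simp add: order_weights_def order_weight_def)
  qed simp
  finally show ?thesis by (simp add: mult.commute)
qed

text \<open>The vertex v_{2k+2} still has a tentative value above 2n^2 - n, while its distance is at
  most n(n - 1). This turns the invariant into a bound on the running time.\<close>

lemma tracks_not_all_distances:
  assumes vs: "order vs" and tr: "tracks vs k b D" and k: "2 * k + 2 < n"
  shows "\<not> all_distances G s (order_weights vs) D"
proof
  assume all: "all_distances G s (order_weights vs) D"
  have len: "length vs = n" using vs by (rule order_length)
  define v where "v = vs ! (2 * k + 2)"
  have "v \<in> set vs" using k len unfolding v_def by (intro nth_mem) simp
  then have "D v = distance G (order_weights vs) s v"
    using all vs by (simp add: all_distances_def order_def)
  also have "\<dots> \<le> int n * int (2 * k + 2)"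
    using distance_order_le[OF vs k] by (simp add: v_def)
  also have "\<dots> \<le> int n * (int n - 1)" using k by (intro mult_left_mono) auto
  also have "\<dots> = int n * int n - int n" by (simp add: right_diff_distrib)
  finally have 1: "D v \<le> int n * int n - int n" .
  have 2: "D v = 2 * int n * int n - int (b v)"
    using tr k len by (simp add: tracks_def v_def state_value_def)
  have "b v \<le> k" using tr by (simp add: tracks_def)
  then have 3: "int (b v) < int n" using k by linarith
  have 4: "0 \<le> int n * int n" by simp
  have "2 * int n * int n = int n * int n + int n * int n" by simp
  with 1 2 3 4 show False by linarith
qed

text \<open>With k = 0 and \<open>b\<close> zero, v_1 already counts as final: its edge from s
  weighs n, all other edges at s weigh 2n^2.\<close>

lemma tracks_initial:
  assumes vs: "order vs"
  shows "tracks vs 0 (\<lambda>_. 0) (initial s (order_weights vs))"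
proof -
  have len: "length vs = n" using vs by (rule order_length)
  have n: "0 < n" using s finite_verts card_verts card_gt_0_iff by blast
  have dist: "distinct vs" using vs by (simp add: order_def)
  have "initial s (order_weights vs) (vs ! i) = state_value n 0 0 i" if i: "i < n" for i
  proof (cases "i = 0")
    case True
    then show ?thesis using order_nth_0[OF vs] by (simp add: initial_def state_value_def)
  next
    case False
    then have "vs ! i \<noteq> vs ! 0"
      using dist i n len by (simp add: nth_eq_iff_index_eq)
    then have 1: "vs ! i \<noteq> s" by (simp add: order_nth_0[OF vs])
    have 2: "position vs (vs ! i) = i" using dist i len by (simp add: position_nth)
    have "position vs (vs ! 0) = 0" using dist n len by (simp add: position_nth)
    then have 3: "position vs s = 0" by (simp add: order_nth_0[OF vs])
    show ?thesis
      using False by (simp add: initial_def order_weights_def order_weight_def len state_value_def 1 2 3)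
  qed
  then show ?thesis using n len by (simp add: tracks_def)
qed

text \<open>Subtrees start from other D-values and do not inherit \<open>correct_algorithm\<close>;
  what they inherit is that the run on this order ends with the distances.\<close>

definition consistent ::
    "('v \<times> 'v) algorithm \<Rightarrow> nat \<Rightarrow> ('v \<Rightarrow> nat) \<Rightarrow> ('v \<Rightarrow> int) \<Rightarrow> 'v list \<Rightarrow> bool" where
  "consistent A k b D vs \<longleftrightarrow> order vs \<and> tracks vs k b D \<and>
     all_distances G s (order_weights vs) (last (trace (order_weights vs) A D))"

definition remaining_time :: "('v \<times> 'v) algorithm \<Rightarrow> ('v \<Rightarrow> int) \<Rightarrow> 'v list \<Rightarrow> real" where
  "remaining_time A D vs =
     real (steps_until (all_distances G s (order_weights vs)) (order_weights vs) A D)"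

text \<open>A known prefix is s followed by whole pairs, hence the odd length.\<close>

definition revealed :: "'v list \<Rightarrow> nat \<Rightarrow> bool" where
  "revealed xs k \<longleftrightarrow> distinct xs \<and> set xs \<subseteq> pverts G \<and> hd xs = s \<and> odd (length xs) \<and> 2 * k < length xs"

lemma order_append:
  assumes "revealed xs k" "ys \<in> permutations_of_set (pverts G - set xs)"
  shows "order (xs @ ys)"
proof -
  have "xs \<noteq> []" using assms by (auto simp: revealed_def)
  then show ?thesis
    using assms permutations_of_setD[OF assms(2)] by (auto simp: revealed_def order_def)
qed

lemma revealed_card:
  assumes "revealed xs k"
  shows "length xs + card (pverts G - set xs) = n"
proof -
  have "card (pverts G - set xs) = n - length xs" "length xs \<le> n"
    using assms card_Diff_subset[of "set xs" "pverts G"] card_mono[OF finite_verts, of "set xs"]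
    by (auto simp: revealed_def card_verts distinct_card)
  then show ?thesis by simp
qed

text \<open>By parity, a path edge found beyond \<open>xs\<close> requires \<open>length xs\<close>
  = 2k + 1, and then its ends are x and y. So a step at any other edge has the same outcome for all
  these orders.\<close>

lemma advance_unrevealed:
  assumes xs: "revealed xs k" and ord: "order (xs @ x # y # zs)"
    and e: "e \<in> parcs G" "e \<noteq> (x, y)"
  shows "advance (xs @ x # y # zs) k b e = advance xs k b e"
proof -
  let ?vs = "xs @ x # y # zs"
  obtain u v where uv: "e = (u, v)" "u \<in> set ?vs" "v \<in> set ?vs"
    using e ord unfolding order_def arcs by blast
  have "2 * k + 2 < length xs \<or> \<not> (position ?vs u = 2 * k + 1 \<and> position ?vs v = 2 * k + 2)"
  proof (rule ccontr)
    assume *: "\<not> ?thesis"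
    have "odd (length xs)" "2 * k < length xs" using xs by (simp_all add: revealed_def)
    moreover have "length xs \<le> 2 * k + 2" using * by simp
    ultimately have "length xs = 2 * k + 1" by presburger
    then have "?vs ! position ?vs u = x" "?vs ! position ?vs v = y"
      using * by (auto simp: nth_append)
    then show False using nth_position[OF uv(2)] nth_position[OF uv(3)] e uv by simp
  qed
  then show ?thesis unfolding uv(1) by (intro advance_append) (use xs in \<open>auto simp: revealed_def\<close>)
qed

lemma consistent_advance:
  assumes "order vs" "tracks vs k b D" "e \<in> parcs G" "advance vs k b e = (a, k', b')"
  shows "query (order_weights vs) e D = a \<and> tracks vs k' b' (relax (order_weights vs) e D)"
proof -
  obtain u v where "e = (u, v)" "u \<in> set vs" "v \<in> set vs" "u \<noteq> v"
    using assms unfolding order_def arcs by blast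
  then show ?thesis using assms tracks_advance[of vs k b D u v a k' b'] by (auto simp: order_def)
qed

text \<open>
  \<open>Q\<close> holds the pairs that are still possible for the two vertices following the known prefix \<open>xs\<close>
  of the order. The prefix may be longer than the \<open>2k + 1\<close> vertices with final values, because a query
  can reveal the next pair before it is relaxed.
\<close>

definition slow :: "('v \<times> 'v) algorithm \<Rightarrow> bool" where
  "slow A \<longleftrightarrow> (\<forall>xs k b D Q. revealed xs k \<longrightarrow>
     Q \<subseteq> {(x, y). x \<in> pverts G - set xs \<and> y \<in> pverts G - set xs \<and> x \<noteq> y} \<longrightarrow>
     (\<forall>(x, y)\<in>Q. \<forall>zs\<in>permutations_of_set (pverts G - set xs - {x, y}).
        consistent A k b (D (xs @ x # y # zs)) (xs @ x # y # zs)) \<longrightarrow>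
     fact (card (pverts G - set xs) - 2) *
       (real (card Q) ^ 2 / 2 + real (card Q) * average_bound (card (pverts G - set xs) - 2)) \<le>
     (\<Sum>(x, y)\<in>Q. \<Sum>zs\<in>permutations_of_set (pverts G - set xs - {x, y}).
        remaining_time A (D (xs @ x # y # zs)) (xs @ x # y # zs)))"

text \<open>For m unrevealed vertices all r = m(m - 1) pairs are possible;
  \<open>fact (m - 2) * r = fact m\<close> and r^2 / 2 + ra = r(r / 2 + a) turn the bound of
  \<open>slow\<close> into the recursion of \<open>average_bound\<close>.\<close>

lemma slow_all_orders:
  assumes A: "slow A" and xs: "revealed xs k"
    and cons: "\<And>ys. ys \<in> permutations_of_set (pverts G - set xs) \<Longrightarrow>
      consistent A k b (D (xs @ ys)) (xs @ ys)"
  shows "fact (card (pverts G - set xs)) * average_bound (card (pverts G - set xs)) \<le>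
    (\<Sum>ys\<in>permutations_of_set (pverts G - set xs). remaining_time A (D (xs @ ys)) (xs @ ys))"
proof -
  define U where "U = pverts G - set xs"
  have U: "finite U" using finite_verts by (simp add: U_def)
  show ?thesis
  proof (cases "card U < 2")
    case True
    then have "average_bound (card U) = 0" by (cases "card U") auto
    then show ?thesis
      unfolding U_def[symmetric] by (simp add: sum_nonneg remaining_time_def)
  next
    case False
    then obtain m where m: "card U = Suc (Suc m)" by (metis Suc_1 add_2_eq_Suc le_Suc_ex not_less)
    define Q where "Q = {(x, y). x \<in> U \<and> y \<in> U \<and> x \<noteq> y}"
    have Q: "real (card Q) = real (Suc (Suc m) * Suc m)"
      using card_off_diagonal[OF U] by (simp only: Q_def m diff_Suc_1)
    have perm: "x # y # zs \<in> permutations_of_set U"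
      if "(x, y) \<in> Q" "zs \<in> permutations_of_set (U - {x, y})" for x y zs
      using that by (auto simp: Q_def permutations_of_set_def)
    have "fact (card U - 2) * (real (card Q) ^ 2 / 2 + real (card Q) * average_bound (card U - 2)) \<le>
      (\<Sum>(x, y)\<in>Q. \<Sum>zs\<in>permutations_of_set (U - {x, y}).
        remaining_time A (D (xs @ x # y # zs)) (xs @ x # y # zs))"
      using A[unfolded slow_def, rule_format, of xs k Q b D, folded U_def] xs perm
        cons[folded U_def] by (auto simp: Q_def)
    also have "\<dots> = (\<Sum>ys\<in>permutations_of_set U. remaining_time A (D (xs @ ys)) (xs @ ys))"
      using False U by (simp add: sum_permutations_of_set_Cons_Cons Q_def)
    also have "fact (card U - 2) * (real (card Q) ^ 2 / 2 + real (card Q) * average_bound (card U - 2)) =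
        fact (card U) * average_bound (card U)"
      unfolding Q by (simp add: m power2_eq_square algebra_simps add_divide_distrib)
    finally show ?thesis by (simp add: U_def)
  qed
qed

text \<open>The step shared by updates and queries. Orders whose next pair is e go on with
  \<open>Ah\<close> and a prefix longer by two, after which every order of the rest is possible; all
  others go on with \<open>Am\<close> and e struck from \<open>Q\<close>. \<open>D'\<close> holds
  the D-values after the step.\<close>

lemma slow_step:
  assumes xs: "revealed xs k"
    and Q: "Q \<subseteq> {(x, y). x \<in> pverts G - set xs \<and> y \<in> pverts G - set xs \<and> x \<noteq> y}"
    and hit: "\<And>x y. e = (x, y) \<Longrightarrow> e \<in> Q \<Longrightarrow> revealed (xs @ [x, y]) kh \<and> slow Ah \<and>
      (\<forall>zs\<in>permutations_of_set (pverts G - set xs - {x, y}).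
         consistent Ah kh bh (D' (xs @ x # y # zs)) (xs @ x # y # zs) \<and>
         remaining_time A (D (xs @ x # y # zs)) (xs @ x # y # zs) =
           remaining_time Ah (D' (xs @ x # y # zs)) (xs @ x # y # zs) + 1)"
    and miss: "revealed xs km" "slow Am"
      "\<And>x y zs. (x, y) \<in> Q \<Longrightarrow> (x, y) \<noteq> e \<Longrightarrow>
         zs \<in> permutations_of_set (pverts G - set xs - {x, y}) \<Longrightarrow>
         consistent Am km bm (D' (xs @ x # y # zs)) (xs @ x # y # zs) \<and>
         remaining_time A (D (xs @ x # y # zs)) (xs @ x # y # zs) =
           remaining_time Am (D' (xs @ x # y # zs)) (xs @ x # y # zs) + 1"
  shows "fact (card (pverts G - set xs) - 2) *
       (real (card Q) ^ 2 / 2 + real (card Q) * average_bound (card (pverts G - set xs) - 2)) \<le>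
     (\<Sum>(x, y)\<in>Q. \<Sum>zs\<in>permutations_of_set (pverts G - set xs - {x, y}).
        remaining_time A (D (xs @ x # y # zs)) (xs @ x # y # zs))"
proof -
  define g where "g x y zs = remaining_time (if (x, y) = e then Ah else Am)
    (D' (xs @ x # y # zs)) (xs @ x # y # zs)" for x y zs
  define U where "U = pverts G - set xs"
  show ?thesis
    unfolding U_def[symmetric]
  proof (rule average_step[where e = e and g = g])
    show U: "finite U" using finite_verts by (simp add: U_def)
    show "Q \<subseteq> {(x, y). x \<in> U \<and> y \<in> U \<and> x \<noteq> y}" using Q by (simp add: U_def)
    show "0 \<le> average_bound (card U - 2)" by (rule average_bound_nonneg)
  next
    assume eQ: "e \<in> Q"
    obtain x y where e: "e = (x, y)" by (cases e)
    have U: "finite U" using finite_verts by (simp add: U_def)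
    have "x \<in> U" "y \<in> U" "x \<noteq> y" using eQ Q e by (auto simp: U_def)
    then have card: "card (U - {x, y}) = card U - 2"
      using U by (subst card_Diff_subset) auto
    have diff: "pverts G - set (xs @ [x, y]) = U - {x, y}" by (auto simp: U_def)
    have h: "revealed (xs @ [x, y]) kh" "slow Ah"
      "\<And>zs. zs \<in> permutations_of_set (U - {x, y}) \<Longrightarrow>
         consistent Ah kh bh (D' (xs @ x # y # zs)) (xs @ x # y # zs)"
      using hit[OF e eQ] by (auto simp: U_def)
    have "fact (card (U - {x, y})) * average_bound (card (U - {x, y})) \<le>
      (\<Sum>zs\<in>permutations_of_set (U - {x, y}).
         remaining_time Ah (D' ((xs @ [x, y]) @ zs)) ((xs @ [x, y]) @ zs))"
      using slow_all_orders[OF h(2) h(1), of bh D', unfolded diff] h(3) by simp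
    then show "fact (card U - 2) * average_bound (card U - 2) \<le>
      (\<Sum>zs\<in>permutations_of_set (U - {fst e, snd e}). g (fst e) (snd e) zs)"
      by (simp add: card e g_def)
  next
    have "fact (card U - 2) * (real (card (Q - {e})) ^ 2 / 2 +
          real (card (Q - {e})) * average_bound (card U - 2)) \<le>
      (\<Sum>(x, y)\<in>Q - {e}. \<Sum>zs\<in>permutations_of_set (U - {x, y}).
        remaining_time Am (D' (xs @ x # y # zs)) (xs @ x # y # zs))"
      unfolding U_def
      by (rule miss(2)[unfolded slow_def, rule_format, of xs km "Q - {e}" bm D'])
        (use Q miss in auto)
    also have "\<dots> = (\<Sum>(x, y)\<in>Q - {e}. \<Sum>zs\<in>permutations_of_set (U - {x, y}). g x y zs)"
      by (intro sum.cong) (auto simp: g_def)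
    finally show "fact (card U - 2) * (real (card (Q - {e})) ^ 2 / 2 +
          real (card (Q - {e})) * average_bound (card U - 2)) \<le>
      (\<Sum>(x, y)\<in>Q - {e}. \<Sum>zs\<in>permutations_of_set (U - {x, y}). g x y zs)" .
  next
    fix x y zs assume "(x, y) \<in> Q" "zs \<in> permutations_of_set (U - {x, y})"
    then show "remaining_time A (D (xs @ x # y # zs)) (xs @ x # y # zs) = g x y zs + 1"
      using hit[of x y] miss(3)[of x y zs] by (auto simp: g_def U_def)
  qed
qed

section \<open>Single steps of a run on a fixed order\<close>

lemma consistent_Update:
  assumes c: "consistent (Update e A) k b D vs" and e: "e \<in> parcs G" and k: "2 * k + 2 < n"
    and adv: "advance vs k b e = (a, k', b')"
  shows "consistent A k' b' (relax (order_weights vs) e D) vs \<and>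
    remaining_time (Update e A) D vs = remaining_time A (relax (order_weights vs) e D) vs + 1"
proof -
  have vs: "order vs" "tracks vs k b D" using c by (simp_all add: consistent_def)
  then show ?thesis
    using c consistent_advance[OF vs e adv] tracks_not_all_distances[OF vs k]
    by (simp add: trace_not_Nil consistent_def remaining_time_def)
qed

lemma consistent_Query:
  assumes c: "consistent (Query e A B) k b D vs" and e: "e \<in> parcs G" and k: "2 * k + 2 < n"
    and adv: "advance vs k b e = (a, k', b')"
  shows "consistent (if a then A else B) k b D vs \<and>
    remaining_time (Query e A B) D vs = remaining_time (if a then A else B) D vs + 1"
proof -
  have vs: "order vs" "tracks vs k b D" using c by (simp_all add: consistent_def)
  have "query (order_weights vs) e D = a" using consistent_advance[OF vs e adv] by simp
  then show ?thesis
    using c vs tracks_not_all_distances[OF vs k]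
    by (simp add: trace_not_Nil consistent_def remaining_time_def)
qed

text \<open>A run that ends with the distances cannot stop while a vertex at position 2k' + 2
  exists, since its value would be tentative.\<close>

lemma consistent_Final:
  assumes c: "consistent (Final e) k b D vs" and e: "e \<in> parcs G"
    and adv: "advance vs k b e = (a, k', b')"
  shows "n \<le> 2 * k' + 2"
proof (rule ccontr)
  assume k': "\<not> ?thesis"
  have vs: "order vs" "tracks vs k b D" using c by (simp_all add: consistent_def)
  have "tracks vs k' b' (relax (order_weights vs) e D)" using consistent_advance[OF vs e adv] by simp
  then show False using c vs k' tracks_not_all_distances[of vs k' b'] by (simp add: consistent_def)
qed

lemma revealed_append:
  assumes "revealed xs k" "x \<in> pverts G - set xs" "y \<in> pverts G - set xs" "x \<noteq> y"
    and "2 * k' < length xs + 2"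
  shows "revealed (xs @ [x, y]) k'"
  using assms by (cases xs) (auto simp: revealed_def)

text \<open>Two more vertices extend the prefix past position 2k + 2, so the outcome is independent
  of \<open>zs\<close> and one state serves all orders with this pair.\<close>

lemma advance_revealed:
  assumes "revealed xs k"
  shows "advance (xs @ x # y # zs) k b e = advance (xs @ [x, y]) k b e"
  using advance_append[of k "xs @ [x, y]" zs "fst e" "snd e" b] assms
  by (simp add: revealed_def)

lemma two_unrevealed:
  assumes "revealed xs k" "x \<in> pverts G - set xs" "y \<in> pverts G - set xs" "x \<noteq> y"
  shows "2 \<le> card (pverts G - set xs)" "2 * k + 2 < n"
proof -
  show "2 \<le> card (pverts G - set xs)"
    using assms finite_verts card_mono[of "pverts G - set xs" "{x, y}"] by simp
  then show "2 * k + 2 < n" using revealed_card[OF assms(1)] assms(1) by (simp add: revealed_def)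
qed

lemma order_append_two:
  assumes "revealed xs k" "x \<in> pverts G - set xs" "y \<in> pverts G - set xs" "x \<noteq> y"
    and "zs \<in> permutations_of_set (pverts G - set xs - {x, y})"
  shows "order (xs @ x # y # zs)"
  by (rule order_append) (use assms in \<open>auto simp: permutations_of_set_def\<close>)

text \<open>Updates keep the subtree and change the state, queries keep the state and choose the
  subtree. In either case the outcome depends on the order only through whether e is its next
  pair.\<close>

lemma slow_algorithm: "alg_edges A \<subseteq> parcs G \<Longrightarrow> slow A"
proof (induction A)
  case (Final e)
  then have e: "e \<in> parcs G" by simp
  show ?case
    unfolding slow_def
  proof (intro allI impI)
    fix xs k b D Q
    let ?U = "pverts G - set xs"
    assume xs: "revealed xs k"
      and Q: "Q \<subseteq> {(x, y). x \<in> ?U \<and> y \<in> ?U \<and> x \<noteq> y}"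
      and c: "\<forall>(x, y)\<in>Q. \<forall>zs\<in>permutations_of_set (?U - {x, y}).
        consistent (Final e) k b (D (xs @ x # y # zs)) (xs @ x # y # zs)"
    obtain a2 k2 b2 where adv2: "advance xs k b e = (a2, k2, b2)" by (metis prod.exhaust)
    obtain a1 k1 b1 where adv1: "advance (xs @ [fst e, snd e]) k b e = (a1, k1, b1)"
      by (metis prod.exhaust)
    have k2: "2 * k2 < length xs"
      using advance_bound[OF _ adv2] xs by (simp add: revealed_def)
    have k1: "2 * k1 < length xs + 2"
      using advance_bound[OF _ adv1] xs by (simp add: revealed_def)
    have inQ: "x \<in> ?U" "y \<in> ?U" "x \<noteq> y" if "(x, y) \<in> Q" for x y using that Q by auto
    have obtain_zs: "\<exists>zs. zs \<in> permutations_of_set (?U - {x, y})" for x y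
      using finite_verts permutations_of_set_empty_iff[of "?U - {x, y}"] by blast
    \<comment> \<open>For any other pair the leaf would leave 2 \<open>k2\<close> <
      \<open>length xs\<close> with two vertices unrevealed, too early for a run to end.\<close>
    have sub: "Q \<subseteq> {e}"
    proof
      fix p assume p: "p \<in> Q"
      obtain x y where xy: "p = (x, y)" by (cases p)
      obtain zs where zs: "zs \<in> permutations_of_set (?U - {x, y})" using obtain_zs by blast
      have U2: "2 \<le> card ?U" using two_unrevealed[OF xs inQ] p xy by blast
      show "p \<in> {e}"
      proof (rule ccontr)
        assume "p \<notin> {e}"
        then have "advance (xs @ x # y # zs) k b e = (a2, k2, b2)"
          using advance_unrevealed[OF xs order_append_two[OF xs inQ zs] e] adv2 p xy by auto
        then have "n \<le> 2 * k2 + 2" using consistent_Final e c p xy zs by blast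
        then show False using U2 k2 revealed_card[OF xs] by simp
      qed
    qed
    show "fact (card ?U - 2) *
        (real (card Q) ^ 2 / 2 + real (card Q) * average_bound (card ?U - 2)) \<le>
      (\<Sum>(x, y)\<in>Q. \<Sum>zs\<in>permutations_of_set (?U - {x, y}).
        remaining_time (Final e) (D (xs @ x # y # zs)) (xs @ x # y # zs))"
    proof (cases "Q = {}")
      case False
      obtain x y where xy: "e = (x, y)" by (cases e)
      then have Q': "Q = {(x, y)}" using sub False by auto
      have xyU: "x \<in> ?U" "y \<in> ?U" "x \<noteq> y" using inQ[of x y] Q' by auto
      obtain zs where zs: "zs \<in> permutations_of_set (?U - {x, y})" using obtain_zs by blast
      have "advance (xs @ x # y # zs) k b e = (a1, k1, b1)"
        using advance_revealed[OF xs, of x y zs b e] adv1 xy by simp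
      then have "n \<le> 2 * k1 + 2" using consistent_Final e c Q' zs by blast
      \<comment> \<open>At most one vertex remains after the pair, so the bound asks for half a step
        per order, and the leaf costs one.\<close>
      then have "card ?U \<le> 3" using k1 revealed_card[OF xs] by simp
      then have "card ?U - 2 = 0 \<or> card ?U - 2 = Suc 0" by linarith
      then have avg: "average_bound (card ?U - 2) = 0" by auto
      have one: "remaining_time (Final e) (D (xs @ x # y # zs)) (xs @ x # y # zs) = 1"
        if "zs \<in> permutations_of_set (?U - {x, y})" for zs
      proof -
        have "consistent (Final e) k b (D (xs @ x # y # zs)) (xs @ x # y # zs)"
          using c Q' that by auto
        then show ?thesis
          using tracks_not_all_distances[of "xs @ x # y # zs" k b] two_unrevealed(2)[OF xs xyU]
          by (simp add: consistent_def remaining_time_def)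
      qed
      have "card (?U - {x, y}) = card ?U - 2"
        using xyU finite_verts by (subst card_Diff_subset) auto
      then have "real (card (permutations_of_set (?U - {x, y}))) = fact (card ?U - 2)"
        using finite_verts by simp
      then show ?thesis by (simp add: Q' one avg)
    qed simp
  qed
next
  case (Update e A)
  then have e: "e \<in> parcs G" and A: "slow A" by auto
  show ?case
    unfolding slow_def
  proof (intro allI impI)
    fix xs k b D Q
    let ?U = "pverts G - set xs"
    assume xs: "revealed xs k"
      and Q: "Q \<subseteq> {(x, y). x \<in> ?U \<and> y \<in> ?U \<and> x \<noteq> y}"
      and c: "\<forall>(x, y)\<in>Q. \<forall>zs\<in>permutations_of_set (?U - {x, y}).
        consistent (Update e A) k b (D (xs @ x # y # zs)) (xs @ x # y # zs)"
    obtain a2 k2 b2 where adv2: "advance xs k b e = (a2, k2, b2)" by (metis prod.exhaust)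
    obtain a1 k1 b1 where adv1: "advance (xs @ [fst e, snd e]) k b e = (a1, k1, b1)"
      by (metis prod.exhaust)
    have k2: "2 * k2 < length xs"
      using advance_bound[OF _ adv2] xs by (simp add: revealed_def)
    have k1: "2 * k1 < length xs + 2"
      using advance_bound[OF _ adv1] xs by (simp add: revealed_def)
    have inQ: "x \<in> ?U" "y \<in> ?U" "x \<noteq> y" if "(x, y) \<in> Q" for x y using that Q by auto
    show "fact (card ?U - 2) *
        (real (card Q) ^ 2 / 2 + real (card Q) * average_bound (card ?U - 2)) \<le>
      (\<Sum>(x, y)\<in>Q. \<Sum>zs\<in>permutations_of_set (?U - {x, y}).
        remaining_time (Update e A) (D (xs @ x # y # zs)) (xs @ x # y # zs))"
    proof (rule slow_step[OF xs Q, where e = e and Ah = A and Am = A and kh = k1 and bh = b1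
          and km = k2 and bm = b2 and D' = "\<lambda>vs. relax (order_weights vs) e (D vs)"])
      fix x y assume xy: "e = (x, y)" and eQ: "e \<in> Q"
      then have adv: "advance (xs @ x # y # zs) k b e = (a1, k1, b1)" for zs
        using advance_revealed[OF xs, of x y zs b e] adv1 by simp
      note xyU = inQ[OF eQ[unfolded xy]]
      show "revealed (xs @ [x, y]) k1 \<and> slow A \<and>
        (\<forall>zs\<in>permutations_of_set (?U - {x, y}).
           consistent A k1 b1 (relax (order_weights (xs @ x # y # zs)) e (D (xs @ x # y # zs)))
             (xs @ x # y # zs) \<and>
           remaining_time (Update e A) (D (xs @ x # y # zs)) (xs @ x # y # zs) =
             remaining_time A (relax (order_weights (xs @ x # y # zs)) e (D (xs @ x # y # zs)))
               (xs @ x # y # zs) + 1)"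
        using revealed_append[OF xs xyU k1] A
          consistent_Update[OF _ e two_unrevealed(2)[OF xs xyU] adv] c eQ xy by blast
    next
      show "revealed xs k2" using xs k2 by (simp add: revealed_def)
    next
      fix x y zs assume xy: "(x, y) \<in> Q" "(x, y) \<noteq> e" "zs \<in> permutations_of_set (?U - {x, y})"
      note xyU = inQ[OF xy(1)]
      have adv: "advance (xs @ x # y # zs) k b e = (a2, k2, b2)"
        using advance_unrevealed[OF xs order_append_two[OF xs xyU xy(3)] e] xy(2) adv2 by metis
      show "consistent A k2 b2 (relax (order_weights (xs @ x # y # zs)) e (D (xs @ x # y # zs)))
             (xs @ x # y # zs) \<and>
           remaining_time (Update e A) (D (xs @ x # y # zs)) (xs @ x # y # zs) =
             remaining_time A (relax (order_weights (xs @ x # y # zs)) e (D (xs @ x # y # zs)))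
               (xs @ x # y # zs) + 1"
        using consistent_Update[OF _ e two_unrevealed(2)[OF xs xyU] adv] c xy by blast
    qed (rule A)
  qed
next
  case (Query e A B)
  then have e: "e \<in> parcs G" and AB: "slow (if a then A else B)" for a by auto
  show ?case
    unfolding slow_def
  proof (intro allI impI)
    fix xs k b D Q
    let ?U = "pverts G - set xs"
    assume xs: "revealed xs k"
      and Q: "Q \<subseteq> {(x, y). x \<in> ?U \<and> y \<in> ?U \<and> x \<noteq> y}"
      and c: "\<forall>(x, y)\<in>Q. \<forall>zs\<in>permutations_of_set (?U - {x, y}).
        consistent (Query e A B) k b (D (xs @ x # y # zs)) (xs @ x # y # zs)"
    obtain a2 k2 b2 where adv2: "advance xs k b e = (a2, k2, b2)" by (metis prod.exhaust)
    obtain a1 k1 b1 where adv1: "advance (xs @ [fst e, snd e]) k b e = (a1, k1, b1)"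
      by (metis prod.exhaust)
    have k: "2 * k < length xs + 2" using xs by (simp add: revealed_def)
    have inQ: "x \<in> ?U" "y \<in> ?U" "x \<noteq> y" if "(x, y) \<in> Q" for x y using that Q by auto
    show "fact (card ?U - 2) *
        (real (card Q) ^ 2 / 2 + real (card Q) * average_bound (card ?U - 2)) \<le>
      (\<Sum>(x, y)\<in>Q. \<Sum>zs\<in>permutations_of_set (?U - {x, y}).
        remaining_time (Query e A B) (D (xs @ x # y # zs)) (xs @ x # y # zs))"
    proof (rule slow_step[OF xs Q, where e = e and Ah = "if a1 then A else B"
          and Am = "if a2 then A else B" and kh = k and bh = b
          and km = k and bm = b and D' = D])
      fix x y assume xy: "e = (x, y)" and eQ: "e \<in> Q"
      then have adv: "advance (xs @ x # y # zs) k b e = (a1, k1, b1)" for zs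
        using advance_revealed[OF xs, of x y zs b e] adv1 by simp
      note xyU = inQ[OF eQ[unfolded xy]]
      show "revealed (xs @ [x, y]) k \<and> slow (if a1 then A else B) \<and>
        (\<forall>zs\<in>permutations_of_set (?U - {x, y}).
           consistent (if a1 then A else B) k b (D (xs @ x # y # zs)) (xs @ x # y # zs) \<and>
           remaining_time (Query e A B) (D (xs @ x # y # zs)) (xs @ x # y # zs) =
             remaining_time (if a1 then A else B) (D (xs @ x # y # zs)) (xs @ x # y # zs) + 1)"
        using revealed_append[OF xs xyU k] AB[of a1]
          consistent_Query[OF _ e two_unrevealed(2)[OF xs xyU] adv] c eQ xy by blast
    next
      fix x y zs assume xy: "(x, y) \<in> Q" "(x, y) \<noteq> e" "zs \<in> permutations_of_set (?U - {x, y})"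
      note xyU = inQ[OF xy(1)]
      have adv: "advance (xs @ x # y # zs) k b e = (a2, k2, b2)"
        using advance_unrevealed[OF xs order_append_two[OF xs xyU xy(3)] e] xy(2) adv2 by metis
      show "consistent (if a2 then A else B) k b (D (xs @ x # y # zs)) (xs @ x # y # zs) \<and>
           remaining_time (Query e A B) (D (xs @ x # y # zs)) (xs @ x # y # zs) =
             remaining_time (if a2 then A else B) (D (xs @ x # y # zs)) (xs @ x # y # zs) + 1"
        using consistent_Query[OF _ e two_unrevealed(2)[OF xs xyU] adv] c xy by blast
    qed (rule xs AB)+
  qed
qed

section \<open>Averages over orders and over random algorithms\<close>

lemma total_running_time_ge:
  assumes A: "correct_algorithm G s A"
  shows "fact (n - 1) * average_bound (n - 1) \<le>
    (\<Sum>ys\<in>permutations_of_set (pverts G - {s}). real (running_time G s (order_weights (s # ys)) A))"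
proof -
  let ?D = "\<lambda>vs. initial s (order_weights vs)"
  have xs: "revealed [s] 0" using s by (simp add: revealed_def)
  have ord: "order (s # ys)" if "ys \<in> permutations_of_set (pverts G - {s})" for ys
    using order_append[OF xs, of ys] that by simp
  have "consistent A 0 (\<lambda>_. 0) (?D ([s] @ ys)) ([s] @ ys)"
    if "ys \<in> permutations_of_set (pverts G - set [s])" for ys
    using ord[of ys] that A tracks_initial no_negative_cycles_order
    by (simp add: consistent_def correct_algorithm_def)
  then have "fact (card (pverts G - set [s])) * average_bound (card (pverts G - set [s])) \<le>
      (\<Sum>ys\<in>permutations_of_set (pverts G - set [s]). remaining_time A (?D ([s] @ ys)) ([s] @ ys))"
    using A by (intro slow_all_orders[OF _ xs] slow_algorithm) (auto simp: correct_algorithm_def)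
  then have "fact (n - 1) * average_bound (n - 1) \<le>
      (\<Sum>ys\<in>permutations_of_set (pverts G - {s}). remaining_time A (?D (s # ys)) (s # ys))"
    using s finite_verts by (simp add: card_verts)
  also have "\<dots> \<le> (\<Sum>ys\<in>permutations_of_set (pverts G - {s}).
      real (running_time G s (order_weights (s # ys)) A))"
  proof (rule sum_mono)
    fix ys assume "ys \<in> permutations_of_set (pverts G - {s})"
    then show "remaining_time A (?D (s # ys)) (s # ys) \<le>
        real (running_time G s (order_weights (s # ys)) A)"
      using steps_until_le_running_time[OF A no_negative_cycles_order[OF ord]]
      by (simp add: remaining_time_def)
  qed
  finally show ?thesis .
qed

text \<open>The average over the (n - 1)! orders is large for each algorithm in the support.
  Exchanging sum and expectation makes the average of the expected times large, so the worst order
  attains the bound. Working in \<open>ennreal\<close> covers infinite expectations.\<close>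

lemma hard_order:
  assumes n: "3 \<le> n" and R: "\<And>A. A \<in> set_pmf R \<Longrightarrow> correct_algorithm G s A"
  obtains vs where "order vs"
    "ennreal (1 / 54 * real n ^ 3) \<le>
      (\<integral>\<^sup>+A. of_nat (running_time G s (order_weights vs) A) \<partial>measure_pmf R)"
proof -
  define P where "P = permutations_of_set (pverts G - {s})"
  define T where "T ys A = running_time G s (order_weights (s # ys)) A" for ys A
  define I where "I ys = (\<integral>\<^sup>+A. of_nat (T ys A) \<partial>measure_pmf R)" for ys
  define c where "c = 1 / 54 * real n ^ 3"
  have cardP: "card P = fact (n - 1)"
    using s finite_verts card_verts by (simp add: P_def)
  have fin: "finite P" by (simp add: P_def)
  have ne: "P \<noteq> {}" using finite_verts by (simp add: P_def)
  have "ennreal (fact (n - 1) * c) \<le> (\<Sum>ys\<in>P. of_nat (T ys A))" if "A \<in> set_pmf R" for A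
  proof -
    have "fact (n - 1) * c \<le> fact (n - 1) * average_bound (n - 1)"
      using average_bound_ge_cube[OF n] by (simp add: c_def)
    also have "\<dots> \<le> (\<Sum>ys\<in>P. real (T ys A))"
      using total_running_time_ge[OF R[OF that]] by (simp add: P_def T_def)
    finally have "ennreal (fact (n - 1) * c) \<le> ennreal (\<Sum>ys\<in>P. real (T ys A))"
      by (rule ennreal_leI)
    also have "\<dots> = (\<Sum>ys\<in>P. of_nat (T ys A))"
      by (subst sum_ennreal[symmetric]) (auto simp: ennreal_of_nat_eq_real_of_nat)
    finally show ?thesis .
  qed
  then have "(\<integral>\<^sup>+A. ennreal (fact (n - 1) * c) \<partial>measure_pmf R) \<le>
      (\<integral>\<^sup>+A. (\<Sum>ys\<in>P. of_nat (T ys A)) \<partial>measure_pmf R)"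
    by (intro nn_integral_mono_AE) (simp add: AE_measure_pmf_iff)
  then have "ennreal (fact (n - 1) * c) \<le> (\<Sum>ys\<in>P. I ys)"
    by (simp add: nn_integral_sum I_def measure_pmf.emeasure_space_1)
  also have "\<dots> \<le> (\<Sum>ys\<in>P. Max (I ` P))"
    using fin by (intro sum_mono) simp
  also have "\<dots> = of_nat (card P) * Max (I ` P)" by simp
  also have "\<dots> = ennreal (fact (n - 1)) * Max (I ` P)"
    by (simp add: cardP ennreal_of_nat_eq_real_of_nat)
  finally have "ennreal (fact (n - 1)) * ennreal c \<le> ennreal (fact (n - 1)) * Max (I ` P)"
    using ennreal_mult'[of "fact (n - 1)" c] by simp
  then have le: "ennreal c \<le> Max (I ` P)"
    by (subst (asm) ennreal_mult_le_mult_iff) auto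
  have "Max (I ` P) \<in> I ` P" using fin ne by (intro Max_in) auto
  then obtain ys where "ys \<in> P" "Max (I ` P) = I ys" by blast
  moreover have "order (s # ys)" if "ys \<in> P"
    using order_append[of "[s]" 0 ys] that s by (simp add: P_def revealed_def)
  ultimately show thesis using that[of "s # ys"] le by (simp add: I_def T_def c_def)
qed

end

theorem theorem1:
  shows "(\<exists>c::real. c > 0 \<and>
           (\<forall>n\<ge>3. \<forall>(G :: nat pair_pre_digraph) s A.
              complete_digraph n (with_proj G) \<longrightarrow> s \<in> pverts G \<longrightarrow> correct_algorithm G s A \<longrightarrow>
              (\<exists>l. no_negative_cycles G l \<and>
                   (\<forall>e\<in>parcs G. 0 \<le> l e) \<and>
                   (\<forall>(u, v)\<in>parcs G. l (u, v) = l (v, u)) \<and>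
                   c * real n ^ 3 \<le> real (running_time G s l A)))) \<and>
         (\<exists>c::real. c > 0 \<and>
           (\<forall>n\<ge>3. \<forall>(G :: nat pair_pre_digraph) s (R :: (nat \<times> nat) algorithm pmf).
              complete_digraph n (with_proj G) \<longrightarrow> s \<in> pverts G \<longrightarrow>
              (\<forall>A\<in>set_pmf R. correct_algorithm G s A) \<longrightarrow>
              (\<exists>l. no_negative_cycles G l \<and>
                   ennreal (c * real n ^ 3)
                     \<le> (\<integral>\<^sup>+A. of_nat (running_time G s l A) \<partial>measure_pmf R))))"
proof (rule conjI; rule exI[of _ "1 / 54 :: real"]; intro conjI allI impI)
  fix n :: nat and G :: "nat pair_pre_digraph" and s A
  assume n: "3 \<le> n" and G: "complete_digraph n (with_proj G)" and s: "s \<in> pverts G"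
    and A: "correct_algorithm G s A"
  interpret complete_graph_order G s n by unfold_locales (fact G s)+
  obtain vs where vs: "order vs" and "ennreal (1 / 54 * real n ^ 3) \<le>
      (\<integral>\<^sup>+A. of_nat (running_time G s (order_weights vs) A) \<partial>measure_pmf (return_pmf A))"
  proof (rule hard_order[OF n, of "return_pmf A"])
    show "correct_algorithm G s B" if "B \<in> set_pmf (return_pmf A)" for B
      using that A by simp
  qed
  then have time: "1 / 54 * real n ^ 3 \<le> real (running_time G s (order_weights vs) A)"
    by (simp add: ennreal_of_nat_eq_real_of_nat)
  have "0 \<le> order_weights vs e" if "e \<in> parcs G" for e
    using order_weights_arc_ge[OF vs that] by linarith
  moreover have "\<forall>(u, v)\<in>parcs G. order_weights vs (u, v) = order_weights vs (v, u)"
    by (auto intro: order_weights_symmetric)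
  ultimately show "\<exists>l. no_negative_cycles G l \<and> (\<forall>e\<in>parcs G. 0 \<le> l e) \<and>
      (\<forall>(u, v)\<in>parcs G. l (u, v) = l (v, u)) \<and> 1 / 54 * real n ^ 3 \<le> real (running_time G s l A)"
    using no_negative_cycles_order[OF vs] time by blast
next
  fix n :: nat and G :: "nat pair_pre_digraph" and s and R :: "(nat \<times> nat) algorithm pmf"
  assume n: "3 \<le> n" and G: "complete_digraph n (with_proj G)" and s: "s \<in> pverts G"
    and R: "\<forall>A\<in>set_pmf R. correct_algorithm G s A"
  interpret complete_graph_order G s n by unfold_locales (fact G s)+
  obtain vs where "order vs" "ennreal (1 / 54 * real n ^ 3) \<le>
      (\<integral>\<^sup>+A. of_nat (running_time G s (order_weights vs) A) \<partial>measure_pmf R)"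
  proof (rule hard_order[OF n, of R])
    show "correct_algorithm G s A" if "A \<in> set_pmf R" for A
      using that R by blast
  qed
  then show "\<exists>l. no_negative_cycles G l \<and> ennreal (1 / 54 * real n ^ 3) \<le>
      (\<integral>\<^sup>+A. of_nat (running_time G s l A) \<partial>measure_pmf R)"
    using no_negative_cycles_order by blast
qed simp_all

end
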